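(* Let $G$ be a graph. If $G\vee K_1$ admits a local antimagic labeling that assigns only integers in $\{1,2,\ldots,|V(G)|\}$ to the edges of $G\vee K_1$ that do not belong to $G$, then $G$ is local super antimagic total.
   Context: Graphs are finite and simple. $G\vee K_1$ is the join: the graph obtained from $G$ by adding one new vertex adjacent to every vertex of $G$. A local antimagic labeling of a graph $H$ of size $m$ is a bijection $g:E(H)\to\{1,\ldots,m\}$ such that $g^+(u)\ne g^+(v)$ for every edge $uv$ of $H$, where $g^+(u)=\sum_{ux\in E(H)}g(ux)$. For a graph $G$ of order $p$ and size $q$, a local antimagic total labeling of $G$ is a bijection $f:V(G)\cup E(G)\to\{1,\ldots,p+q\}$ such that $w_f(u)\neq w_f(v)$ for every edge $uv$ of $G$, where $w_f(u)=f(u)+\sum_{ux\in E(G)}f(ux)$. It is a local super antimagic total labeling if in addition $f(v)\in\{1,\ldots,p\}$ for each $v\in V(G)$; $G$ is local super antimagic total if it admits such a labeling. *)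

theory Defs
  imports Main
begin

record 'a graph =
  verts :: "'a set"
  edges :: "'a set set"

definition simple_graph :: "'a graph \<Rightarrow> bool" where
  "simple_graph G \<longleftrightarrow>
     finite (verts G) \<and> (\<forall>e\<in>edges G. e \<subseteq> verts G \<and> card e = 2)"

text \<open>
  The join of \<open>G\<close> with a single vertex lives on the type \<open>'a option\<close>, so that \<open>None\<close> is always
  available as the new vertex; \<open>embed_edges G\<close> are the edges of \<open>G\<close> seen as edges of the join.
\<close>

definition embed_edges :: "'a graph \<Rightarrow> 'a option set set" where
  "embed_edges G = (\<lambda>e. Some ` e) ` edges G"

definition join_K1 :: "'a graph \<Rightarrow> 'a option graph" where
  "join_K1 G = \<lparr> verts = insert None (Some ` verts G),
                edges = embed_edges G \<union> {{None, Some v} | v. v \<in> verts G} \<rparr>"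

lemma simple_graph_join_K1:
  assumes "simple_graph G"
  shows "simple_graph (join_K1 G)"
  using assms
  by (auto simp: simple_graph_def join_K1_def embed_edges_def card_image)

definition vertex_sum :: "'a graph \<Rightarrow> ('a set \<Rightarrow> nat) \<Rightarrow> 'a \<Rightarrow> nat" where
  "vertex_sum H g u = (\<Sum>x | {u, x} \<in> edges H. g {u, x})"

definition local_antimagic_labeling :: "'a graph \<Rightarrow> ('a set \<Rightarrow> nat) \<Rightarrow> bool" where
  "local_antimagic_labeling H g \<longleftrightarrow>
     bij_betw g (edges H) {1..card (edges H)} \<and>
     (\<forall>u v. {u, v} \<in> edges H \<longrightarrow> vertex_sum H g u \<noteq> vertex_sum H g v)"

text \<open>
  A total labeling is a function on the disjoint union of the vertex set and the edge set:
  \<open>f (Inl v)\<close> is the label of the vertex \<open>v\<close>, \<open>f (Inr e)\<close> that of the edge \<open>e\<close>.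
\<close>

definition total_weight :: "'a graph \<Rightarrow> ('a + 'a set \<Rightarrow> nat) \<Rightarrow> 'a \<Rightarrow> nat" where
  "total_weight G f u = f (Inl u) + (\<Sum>x | {u, x} \<in> edges G. f (Inr {u, x}))"

definition local_antimagic_total_labeling :: "'a graph \<Rightarrow> ('a + 'a set \<Rightarrow> nat) \<Rightarrow> bool" where
  "local_antimagic_total_labeling G f \<longleftrightarrow>
     bij_betw f (verts G <+> edges G) {1..card (verts G) + card (edges G)} \<and>
     (\<forall>u v. {u, v} \<in> edges G \<longrightarrow> total_weight G f u \<noteq> total_weight G f v)"

definition local_super_antimagic_total_labeling ::
    "'a graph \<Rightarrow> ('a + 'a set \<Rightarrow> nat) \<Rightarrow> bool" where
  "local_super_antimagic_total_labeling G f \<longleftrightarrow>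
     local_antimagic_total_labeling G f \<and> (\<forall>v\<in>verts G. f (Inl v) \<in> {1..card (verts G)})"

definition local_super_antimagic_total :: "'a graph \<Rightarrow> bool" where
  "local_super_antimagic_total G \<longleftrightarrow> (\<exists>f. local_super_antimagic_total_labeling G f)"

end

theory Submission
  imports Defs
begin

text \<open>
  The edges of the join with the new vertex correspond to the vertices and edges of \<open>G\<close>:
  a vertex \<open>v\<close> is represented by the edge that joins it to the new vertex, an edge of \<open>G\<close> by its copy in the join.
  Pulling an edge labeling \<open>g\<close> of the join back along this correspondence gives a total labeling of
  \<open>G\<close>. At a vertex of \<open>G\<close>, the sum of \<open>g\<close> in the join splits into the label of the edge to the new
  vertex and the labels of the edges of \<open>G\<close>, which is the weight of the total labeling
  (lemma \<open>vertex_sum_join_K1\<close>). So the antimagic condition for \<open>g\<close>, restricted to the edges of \<open>G\<close>,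
  is the one for the total labeling, and the bound on the labels outside \<open>G\<close> makes it super.
\<close>

definition edge_of_join :: "'a + 'a set \<Rightarrow> 'a option set" where
  "edge_of_join = case_sum (\<lambda>v. {None, Some v}) (image Some)"

lemma edge_of_join_simps [simp]:
  "edge_of_join (Inl v) = {None, Some v}"
  "edge_of_join (Inr e) = Some ` e"
  by (simp_all add: edge_of_join_def)

lemma None_edge_notin_embed_edges: "{None, Some v} \<notin> embed_edges G"
proof
  assume "{None, Some v} \<in> embed_edges G"
  then obtain e where "{None, Some v} = Some ` e"
    unfolding embed_edges_def by blast
  then have "None \<in> Some ` e"
    by blast
  then show False
    by blast
qed

lemma None_edge_in_join_K1_iff: "{None, Some v} \<in> edges (join_K1 G) \<longleftrightarrow> v \<in> verts G"
  by (simp add: join_K1_def None_edge_notin_embed_edges doubleton_eq_iff)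

lemma Some_edge_in_join_K1_iff: "{Some u, Some v} \<in> edges (join_K1 G) \<longleftrightarrow> {u, v} \<in> edges G"
proof -
  have "{Some u, Some v} \<in> edges (join_K1 G) \<longleftrightarrow> Some ` {u, v} \<in> (`) Some ` edges G"
    by (auto simp: join_K1_def embed_edges_def)
  also have "\<dots> \<longleftrightarrow> {u, v} \<in> edges G"
    by (rule inj_image_mem_iff) (simp add: inj_def inj_image_eq_iff[OF inj_Some])
  finally show ?thesis .
qed

lemma bij_betw_edge_of_join:
  "bij_betw edge_of_join (verts G <+> edges G) (edges (join_K1 G))"
proof (rule bij_betw_imageI)
  show "inj_on edge_of_join (verts G <+> edges G)"
    by (auto simp: inj_on_def doubleton_eq_iff inj_image_eq_iff[OF inj_Some])
  show "edge_of_join ` (verts G <+> edges G) = edges (join_K1 G)"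
    by (auto simp: join_K1_def embed_edges_def Plus_def image_Un image_image)
qed

lemma simple_graph_finite_edges:
  assumes "simple_graph G"
  shows "finite (edges G)"
proof (rule finite_subset)
  show "edges G \<subseteq> Pow (verts G)" and "finite (Pow (verts G))"
    using assms by (auto simp: simple_graph_def)
qed

lemma card_edges_join_K1:
  assumes "simple_graph G"
  shows "card (edges (join_K1 G)) = card (verts G) + card (edges G)"
  using bij_betw_same_card[OF bij_betw_edge_of_join[of G]] assms
  by (simp add: card_Plus simple_graph_finite_edges simple_graph_def)

text \<open>
  The neighbours of \<open>Some u\<close> in the join are \<open>None\<close> and the copies of the neighbours of \<open>u\<close>, so its
  vertex sum has one term more than the edge part of the weight of \<open>u\<close>, which is the label
  that \<open>u\<close> receives.
\<close>

lemma vertex_sum_join_K1: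
  assumes "simple_graph G" and "u \<in> verts G"
  shows "vertex_sum (join_K1 G) g (Some u) = total_weight G (g \<circ> edge_of_join) u"
proof -
  let ?N = "{x. {u, x} \<in> edges G}"
  have "?N \<subseteq> verts G"
    using assms(1) by (auto simp: simple_graph_def)
  then have "finite ?N"
    using assms(1) finite_subset by (auto simp: simple_graph_def)
  have "{Some u, x} \<in> edges (join_K1 G) \<longleftrightarrow> x \<in> insert None (Some ` ?N)" for x
  proof (cases x)
    case None
    then show ?thesis
      using assms(2) None_edge_in_join_K1_iff[of u G] by (simp add: insert_commute[of "Some u"])
  next
    case (Some y)
    then show ?thesis
      by (simp add: Some_edge_in_join_K1_iff image_iff)
  qed
  then have "vertex_sum (join_K1 G) g (Some u) = (\<Sum>x\<in>insert None (Some ` ?N). g {Some u, x})"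
    unfolding vertex_sum_def by (intro sum.cong) auto
  also have "\<dots> = g {Some u, None} + (\<Sum>x\<in>Some ` ?N. g {Some u, x})"
    using \<open>finite ?N\<close> by simp
  also have "\<dots> = g {None, Some u} + (\<Sum>x\<in>?N. g {Some u, Some x})"
    by (simp add: sum.reindex insert_commute[of "Some u" None])
  also have "\<dots> = total_weight G (g \<circ> edge_of_join) u"
    by (simp add: total_weight_def)
  finally show ?thesis .
qed

theorem theorem2p2:
  fixes G :: "'a graph"
  assumes "simple_graph G"
    and "\<exists>g. local_antimagic_labeling (join_K1 G) g \<and>
             (\<forall>e \<in> edges (join_K1 G) - embed_edges G. g e \<in> {1..card (verts G)})"
  shows "local_super_antimagic_total G"
proof -
  obtain g where g: "local_antimagic_labeling (join_K1 G) g"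
    and small: "\<And>e. e \<in> edges (join_K1 G) - embed_edges G \<Longrightarrow> g e \<in> {1..card (verts G)}"
    using assms(2) by blast
  let ?f = "g \<circ> edge_of_join"
  have "bij_betw g (edges (join_K1 G)) {1..card (verts G) + card (edges G)}"
    using g by (simp add: local_antimagic_labeling_def card_edges_join_K1[OF assms(1)])
  then have "bij_betw ?f (verts G <+> edges G) {1..card (verts G) + card (edges G)}"
    by (rule bij_betw_trans[OF bij_betw_edge_of_join])
  moreover have "total_weight G ?f u \<noteq> total_weight G ?f v" if uv: "{u, v} \<in> edges G" for u v
  proof -
    have "u \<in> verts G" "v \<in> verts G"
      using assms(1) uv by (auto simp: simple_graph_def)
    moreover have "vertex_sum (join_K1 G) g (Some u) \<noteq> vertex_sum (join_K1 G) g (Some v)"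
      using g uv by (simp add: local_antimagic_labeling_def Some_edge_in_join_K1_iff)
    ultimately show ?thesis
      by (simp add: vertex_sum_join_K1[OF assms(1)])
  qed
  moreover have "?f (Inl v) \<in> {1..card (verts G)}" if "v \<in> verts G" for v
    using small[of "{None, Some v}"] that
    by (simp add: None_edge_in_join_K1_iff None_edge_notin_embed_edges)
  ultimately show ?thesis
    unfolding local_super_antimagic_total_def local_super_antimagic_total_labeling_def
      local_antimagic_total_labeling_def
    by blast
qed

end
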